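(* Let $f_1,\dots,f_K$ be real-valued functions of the covariate. For $t\in\{0,1\}$ and $k\in\{1,\dots,K\}$ put $f_k^0(t,x)=(1-t)f_k(x)$ and $f_k^1(t,x)=t f_k(x)$, and let $\mathcal{F}=\{f_k^t : t\in\{0,1\},\ k\in\{1,\dots,K\}\}$. For $\lambda>0$ let $$\mathbf{w}(\lambda)=(\mathbf{w}^0(\lambda),\mathbf{w}^1(\lambda))=\operatorname*{arg\,min}_{\mathbf{w}\in\Lambda_{0,1}} \ \mathrm{IPM}_{\mathcal{F}}^2\big(\hat P^{\mathbf{w}}_{T,X},\hat Q_{T,X}\big)+\lambda\|\mathbf{w}\|_2^2,$$ where $\Lambda_{0,1}=\{\mathbf{w}=(\mathbf{w}^0,\mathbf{w}^1)\ge 0:\ \sum_{i=1}^{n_t}w_i^t=n_t/n,\ t\in\{0,1\}\}$ and $\hat Q_{T,X}=\hat P_T\otimes\hat P_X$. Then for any $\lambda>0$ there is $(\delta_0,\delta_1)$ with $\delta_0>0$, $\delta_1>0$ such that $$\forall t\in\{0,1\},\qquad \mathbf{w}^t(\lambda)=\tilde{\mathbf{w}}^t(\delta_t),$$ where for $t\in\{0,1\}$ the (approximate balancing) weights are $$\tilde{\mathbf{w}}^t(\delta_t)=\operatorname*{arg\,min}\Big\{\|\tilde{\mathbf{w}}\|_2^2:\ \tfrac{n}{n_t}\tilde{\mathbf{w}}\in\Lambda_{n_t},\ \ \Big|\tfrac1{n_t}\sum_{i=1}^{n_t}n\tilde w_i f_k(X_{i+t n_0})-\bar f_k\Big|\le\delta_t\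 \ \forall k\in\{1,\dots,K\}\Big\},\qquad \bar f_k=\frac1n\sum_{i=1}^n f_k(X_i).$$
   Context: The data are $(T_i,X_i)_{i=1}^n$ with binary treatment $T_i\in\{0,1\}$ and covariates $X_i$. The observations are ordered so that the first $n_0>0$ observations are the control group ($T_i=0$) and the last $n_1=n-n_0>0$ observations are the treated group ($T_i=1$). A weight vector $\mathbf{w}\in\mathbb{R}^n$ is split as $\mathbf{w}=(\mathbf{w}^0,\mathbf{w}^1)$, with $\mathbf{w}^0$ its first $n_0$ entries and $\mathbf{w}^1$ its last $n_1$ entries. $\Lambda_m=\{\mathbf{w}\in\mathbb{R}^m:\mathbf{w}\ge0,\ \sum_i w_i=1\}$ is the simplex. $\hat P^{\mathbf{w}}_{T,X}=\sum_{i=1}^n w_i\delta_{(T_i,X_i)}$ is the weighted empirical distribution ($\delta_z$ is the Dirac mass at $z$). $\hat P_T=\frac1n\sum_i\delta_{T_i}$ and $\hat P_X=\frac1n\sum_i\delta_{X_i}$ are the marginal empirical distributions. For a class $\mathcal{F}$ of measurable functions and probability measures $P_0,Q_0$, the integral probability metric is $\mathrm{IPM}_{\mathcal{F}}(P_0,Q_0)=\sup_{f\in\mathcal{F}}|\mathbb{E}_{Z\sim P_0}[f(Z)]-\mathbb{E}_{Z\sim Q_0}[f(Z)]|$. *)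

theory Defs
  imports "HOL-Probability.Probability"
begin

text \<open>A vector in \<open>R^m\<close> is an extensional function on the index set \<open>{1..m}\<close>, so that two vectors
  are equal iff all their \<open>m\<close> entries are. The squared Euclidean norm of such a vector \<open>w\<close> is
  \<open>(L2_set w {1..m})\<^sup>2\<close>.\<close>

definition unit_simplex :: "nat \<Rightarrow> (nat \<Rightarrow> real) set" where
  "unit_simplex m = {w \<in> {1..m} \<rightarrow>\<^sub>E {0..}. (\<Sum>i = 1..m. w i) = 1}"

text \<open>Treatment arms are the naturals \<open>0\<close> (control) and \<open>1\<close> (treated). Observations \<open>1, \<dots>, n0\<close>
  are controls and \<open>n0 + 1, \<dots>, n\<close> are treated, so entry \<open>i\<close> of arm \<open>t\<close> is observation \<open>i + t * n0\<close>.\<close>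

definition arm_size :: "nat \<Rightarrow> nat \<Rightarrow> nat \<Rightarrow> nat" where
  "arm_size n n0 t = (if t = 0 then n0 else n - n0)"

definition arm_part :: "nat \<Rightarrow> nat \<Rightarrow> nat \<Rightarrow> (nat \<Rightarrow> real) \<Rightarrow> nat \<Rightarrow> real" where
  "arm_part n n0 t w = (\<lambda>i\<in>{1..arm_size n n0 t}. w (i + t * n0))"

definition arm_simplex :: "nat \<Rightarrow> nat \<Rightarrow> (nat \<Rightarrow> real) set" where
  "arm_simplex n n0 =
     {w \<in> {1..n} \<rightarrow>\<^sub>E {0..}.
        \<forall>t\<in>{0, 1}. (\<Sum>i = 1..arm_size n n0 t. arm_part n n0 t w i)
                      = real (arm_size n n0 t) / real n}"

text \<open>The sum of the Dirac masses at \<open>Z i\<close> with weights \<open>w i\<close>, as the image under \<open>Z\<close> of the measure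
  on \<open>{1..n}\<close> with point masses \<open>w i\<close>. It is only meaningful for nonnegative weights, since
  \<open>ennreal\<close> sends negative reals to \<open>0\<close>.\<close>

definition weighted_empirical ::
    "'z measure \<Rightarrow> nat \<Rightarrow> (nat \<Rightarrow> 'z) \<Rightarrow> (nat \<Rightarrow> real) \<Rightarrow> 'z measure" where
  "weighted_empirical M n Z w = distr (point_measure {1..n} (\<lambda>i. ennreal (w i))) M Z"

definition empirical :: "'z measure \<Rightarrow> nat \<Rightarrow> (nat \<Rightarrow> 'z) \<Rightarrow> 'z measure" where
  "empirical M n Z = weighted_empirical M n Z (\<lambda>i. 1 / real n)"

text \<open>The supremum is taken in the reals, so it is the intended one only when the set of
  discrepancies is nonempty and bounded, as for a finite nonempty class \<open>F\<close>.\<close>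

definition IPM :: "('z \<Rightarrow> real) set \<Rightarrow> 'z measure \<Rightarrow> 'z measure \<Rightarrow> real" where
  "IPM F P Q = (SUP f\<in>F. \<bar>(\<integral>z. f z \<partial>P) - (\<integral>z. f z \<partial>Q)\<bar>)"

definition arm_function :: "nat \<Rightarrow> ('x \<Rightarrow> real) \<Rightarrow> nat \<times> 'x \<Rightarrow> real" where
  "arm_function s g = (\<lambda>(t, x). if s = 0 then (1 - real t) * g x else real t * g x)"

definition arm_class :: "nat \<Rightarrow> (nat \<Rightarrow> 'x \<Rightarrow> real) \<Rightarrow> (nat \<times> 'x \<Rightarrow> real) set" where
  "arm_class K f = {arm_function t (f k) | t k. t \<in> {0, 1} \<and> k \<in> {1..K}}"

definition ipm_objective ::
    "'x measure \<Rightarrow> nat \<Rightarrow> (nat \<Rightarrow> nat) \<Rightarrow> (nat \<Rightarrow> 'x) \<Rightarrow> nat \<Rightarrow> (nat \<Rightarrow> 'x \<Rightarrow> real) \<Rightarrow> real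
       \<Rightarrow> (nat \<Rightarrow> real) \<Rightarrow> real" where
  "ipm_objective MX n T X K f lam w =
     (IPM (arm_class K f)
        (weighted_empirical (count_space {0, 1} \<Otimes>\<^sub>M MX) n (\<lambda>i. (T i, X i)) w)
        (empirical (count_space {0, 1}) n T \<Otimes>\<^sub>M empirical MX n X))\<^sup>2
     + lam * (L2_set w {1..n})\<^sup>2"

definition ipm_weights ::
    "'x measure \<Rightarrow> nat \<Rightarrow> nat \<Rightarrow> (nat \<Rightarrow> nat) \<Rightarrow> (nat \<Rightarrow> 'x) \<Rightarrow> nat \<Rightarrow> (nat \<Rightarrow> 'x \<Rightarrow> real) \<Rightarrow> real
       \<Rightarrow> nat \<Rightarrow> real" where
  "ipm_weights MX n n0 T X K f lam =
     arg_min (ipm_objective MX n T X K f lam) (\<lambda>w. w \<in> arm_simplex n n0)"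

definition covariate_mean :: "nat \<Rightarrow> (nat \<Rightarrow> 'x) \<Rightarrow> ('x \<Rightarrow> real) \<Rightarrow> real" where
  "covariate_mean n X g = 1 / real n * (\<Sum>i = 1..n. g (X i))"

definition balancing_feasible ::
    "nat \<Rightarrow> nat \<Rightarrow> (nat \<Rightarrow> 'x) \<Rightarrow> nat \<Rightarrow> (nat \<Rightarrow> 'x \<Rightarrow> real) \<Rightarrow> nat \<Rightarrow> real \<Rightarrow> (nat \<Rightarrow> real) set" where
  "balancing_feasible n n0 X K f t \<delta> =
     (let nt = arm_size n n0 t in
      {v \<in> {1..nt} \<rightarrow>\<^sub>E UNIV.
         (\<lambda>i\<in>{1..nt}. real n / real nt * v i) \<in> unit_simplex nt \<and>
         (\<forall>k\<in>{1..K}.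
            \<bar>1 / real nt * (\<Sum>i = 1..nt. real n * v i * f k (X (i + t * n0)))
               - covariate_mean n X (f k)\<bar> \<le> \<delta>)})"

definition balancing_objective :: "nat \<Rightarrow> nat \<Rightarrow> nat \<Rightarrow> (nat \<Rightarrow> real) \<Rightarrow> real" where
  "balancing_objective n n0 t v = (L2_set v {1..arm_size n n0 t})\<^sup>2"

definition balancing_weights ::
    "nat \<Rightarrow> nat \<Rightarrow> (nat \<Rightarrow> 'x) \<Rightarrow> nat \<Rightarrow> (nat \<Rightarrow> 'x \<Rightarrow> real) \<Rightarrow> nat \<Rightarrow> real \<Rightarrow> nat \<Rightarrow> real" where
  "balancing_weights n n0 X K f t \<delta> =
     arg_min (balancing_objective n n0 t) (\<lambda>v. v \<in> balancing_feasible n n0 X K f t \<delta>)"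

end

theory Submission
  imports Defs
begin

text \<open>The IPM is the maximum \<open>D w\<close> of the absolute imbalances of the functions \<open>f k\<close> in the two arms,
  and the squared norm is the sum of the squared norms of the arms. Let \<open>w\<close> be the penalized minimizer
  and suppose that it minimizes the norm among the weights with \<open>D \<le> \<mu>\<close>. Replacing one arm
  of \<open>w\<close> by weights whose imbalances are at most \<open>\<mu>\<close> keeps \<open>D \<le> \<mu>\<close>, hence cannot decrease the norm
  of that arm: each arm solves its own balancing problem with tolerance \<open>\<mu> n / n\<^sub>t\<close>.\<close>

section \<open>Quadratic penalties on sets of extensional functions\<close>

text \<open>The restriction to \<open>{1..m}\<close> keeps the combination extensional, as all
  vectors here are. Segments start at \<open>u\<close> for \<open>e = 0\<close>.\<close>

definition mix :: "nat \<Rightarrow> real \<Rightarrow> (nat \<Rightarrow> real) \<Rightarrow> (nat \<Rightarrow> real) \<Rightarrow> nat \<Rightarrow> real" where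
  "mix m e u v = (\<lambda>i\<in>{1..m}. (1 - e) * u i + e * v i)"

lemma sum_mix_mult:
  "(\<Sum>i=1..m. mix m e u v i * c i) = (1 - e) * (\<Sum>i=1..m. u i * c i) + e * (\<Sum>i=1..m. v i * c i)"
  by (simp add: mix_def sum_distrib_left distrib_right mult.assoc flip: sum.distrib)

lemma sum_mix: "(\<Sum>i=1..m. mix m e u v i) = (1 - e) * (\<Sum>i=1..m. u i) + e * (\<Sum>i=1..m. v i)"
  using sum_mix_mult[of m e u v "\<lambda>_. 1"] by (simp only: mult_1_right)

lemma L2_set_power2: "(L2_set w A)\<^sup>2 = (\<Sum>i\<in>A. (w i)\<^sup>2)"
  by (simp add: L2_set_def sum_nonneg)

text \<open>Strong convexity as an identity. The subtracted term yields uniqueness at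
  \<open>e = 1/2\<close>; dropping it gives plain convexity.\<close>

lemma L2_set_mix_power2:
  "(L2_set (mix m e u v) {1..m})\<^sup>2 =
     (1 - e) * (L2_set u {1..m})\<^sup>2 + e * (L2_set v {1..m})\<^sup>2
       - e * (1 - e) * (\<Sum>i=1..m. (u i - v i)\<^sup>2)"
proof -
  have "(L2_set (mix m e u v) {1..m})\<^sup>2 = (\<Sum>i=1..m. ((1 - e) * u i + e * v i)\<^sup>2)"
    by (simp add: L2_set_power2 mix_def)
  also have "\<dots> = (\<Sum>i=1..m. (1 - e) * (u i)\<^sup>2 + e * (v i)\<^sup>2 - e * (1 - e) * (u i - v i)\<^sup>2)"
    by (intro sum.cong refl) (simp add: power2_eq_square algebra_simps)
  finally show ?thesis
    by (simp add: L2_set_power2 sum.distrib sum_subtractf sum_distrib_left)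
qed

text \<open>At the midpoint of two minimizers the objective drops by at least \<open>c / 4\<close>
  times their squared distance, which must therefore vanish. Keeping \<open>g\<close> general covers
  both the squared IPM and the pure norm problem \<open>g = 0\<close>.\<close>

lemma is_arg_min_penalized_unique:
  fixes g :: "(nat \<Rightarrow> real) \<Rightarrow> real"
  assumes u: "is_arg_min (\<lambda>w. g w + c * (L2_set w {1..m})\<^sup>2) (\<lambda>w. w \<in> S) u"
    and v: "is_arg_min (\<lambda>w. g w + c * (L2_set w {1..m})\<^sup>2) (\<lambda>w. w \<in> S) v"
    and S: "S \<subseteq> extensional {1..m}" and mid: "mix m (1/2) u v \<in> S"
    and g: "g (mix m (1/2) u v) \<le> (g u + g v) / 2" and "c > 0"
  shows "u = v"
proof (rule extensionalityI[where A = "{1..m}"])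
  show "u \<in> extensional {1..m}" "v \<in> extensional {1..m}"
    using u v S by (auto simp: is_arg_min_def)
  let ?h = "\<lambda>w. g w + c * (L2_set w {1..m})\<^sup>2" and ?D = "\<Sum>i=1..m. (u i - v i)\<^sup>2"
  have "?h u \<le> ?h (mix m (1/2) u v)" "?h v \<le> ?h (mix m (1/2) u v)"
    using u v mid unfolding is_arg_min_linorder by blast+
  moreover have "?h (mix m (1/2) u v) \<le> (?h u + ?h v) / 2 - c * ?D / 4"
    using g unfolding L2_set_mix_power2 by (simp add: algebra_simps)
  ultimately have "c * ?D \<le> 0" by argo
  hence "?D \<le> 0" using \<open>c > 0\<close> by (simp add: mult_le_0_iff)
  hence "?D = 0" by (simp add: sum_nonneg order_antisym)
  thus "u i = v i" if "i \<in> {1..m}" for i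
    using that by (simp add: sum_nonneg_eq_0_iff)
qed

text \<open>Taking \<open>\<mu> = D w\<close> is not allowed if \<open>D w = 0\<close>. But then the squared penalty
  is of second order along segments starting at \<open>w\<close>, so that \<open>w\<close> minimizes the norm over all of \<open>S\<close> and any \<open>\<mu>\<close> works.\<close>

lemma penalized_arg_min_constrained:
  fixes D :: "(nat \<Rightarrow> real) \<Rightarrow> real"
  assumes w: "is_arg_min (\<lambda>w. (D w)\<^sup>2 + c * (L2_set w {1..m})\<^sup>2) (\<lambda>w. w \<in> S) w"
    and S: "\<And>u v e. u \<in> S \<Longrightarrow> v \<in> S \<Longrightarrow> 0 \<le> e \<Longrightarrow> e \<le> 1 \<Longrightarrow> mix m e u v \<in> S"
    and D_nonneg: "\<And>u. D u \<ge> 0"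
    and D: "\<And>u v e. 0 \<le> e \<Longrightarrow> e \<le> 1 \<Longrightarrow> D (mix m e u v) \<le> (1 - e) * D u + e * D v"
    and "c > 0"
  obtains \<mu> where "\<mu> > 0" "D w \<le> \<mu>"
    "\<And>u. u \<in> S \<Longrightarrow> D u \<le> \<mu> \<Longrightarrow> (L2_set w {1..m})\<^sup>2 \<le> (L2_set u {1..m})\<^sup>2"
proof -
  let ?N = "\<lambda>w. (L2_set w {1..m})\<^sup>2"
  have wS: "w \<in> S"
    and opt: "\<And>u. u \<in> S \<Longrightarrow> (D w)\<^sup>2 + c * ?N w \<le> (D u)\<^sup>2 + c * ?N u"
    using w unfolding is_arg_min_linorder by blast+
  consider "D w > 0" | "D w = 0" using D_nonneg[of w] by linarith
  thus ?thesis
  proof cases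
    case 1
    have "?N w \<le> ?N u" if "u \<in> S" "D u \<le> D w" for u
    proof -
      have "(D u)\<^sup>2 \<le> (D w)\<^sup>2" using that D_nonneg by (simp add: power_mono)
      hence "c * ?N w \<le> c * ?N u" using opt[OF that(1)] by linarith
      thus ?thesis using \<open>c > 0\<close> by simp
    qed
    with 1 that show ?thesis by blast
  next
    case 2
    have "?N w \<le> ?N u" if u: "u \<in> S" for u
    proof -
      \<comment> \<open>Optimality of \<open>w\<close> against the point \<open>mix m e w u\<close>:
        the norm term changes to first order in \<open>e\<close>, the penalty is at most
        \<open>(e * D u)\<^sup>2\<close>. Dividing by \<open>e\<close> leaves this bound, and
        \<open>e\<close> then tends to 0 from the right.\<close>
      have bound: "c * (?N w - ?N u) \<le> e * (D u)\<^sup>2" if e: "0 < e" "e \<le> 1" for e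
      proof -
        have "0 \<le> e * (1 - e) * (\<Sum>i=1..m. (w i - u i)\<^sup>2)"
          using e by (simp add: sum_nonneg)
        hence "c * ?N (mix m e w u) \<le> c * ((1 - e) * ?N w + e * ?N u)"
          using \<open>c > 0\<close> unfolding L2_set_mix_power2 by (intro mult_left_mono) auto
        moreover have "(D (mix m e w u))\<^sup>2 \<le> (e * D u)\<^sup>2"
          using D[of e w u] e 2 D_nonneg by (intro power_mono) auto
        ultimately have "c * ?N w \<le> (e * D u)\<^sup>2 + c * ((1 - e) * ?N w + e * ?N u)"
          using opt[OF S[OF wS u, of e]] e 2 by simp
        hence "e * (c * (?N w - ?N u)) \<le> e * (e * (D u)\<^sup>2)"
          by (simp add: power2_eq_square algebra_simps)
        thus ?thesis using e by simp
      qed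
      have lim: "((\<lambda>e. e * (D u)\<^sup>2) \<longlongrightarrow> 0 * (D u)\<^sup>2) (at_right 0)"
        by (intro tendsto_intros)
      have "\<forall>\<^sub>F e in at_right 0. c * (?N w - ?N u) \<le> e * (D u)\<^sup>2"
        using bound eventually_at_right_real[of 0 "1::real"]
        by (auto elim!: eventually_mono)
      from tendsto_lowerbound[OF lim this] have "c * (?N w - ?N u) \<le> 0" by simp
      thus ?thesis using \<open>c > 0\<close> by (simp add: mult_le_0_iff)
    qed
    with 2 that[of 1] show ?thesis by simp
  qed
qed

section \<open>Suprema of finitely many absolute values\<close>

text \<open>A finite supremum is an iterated binary maximum. This gives continuity of the objective,
  hence existence of a minimizer.\<close>

lemma continuous_on_SUP_finite:
  fixes h :: "'j \<Rightarrow> 'a::topological_space \<Rightarrow> real"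
  assumes "finite J" "J \<noteq> {}" "\<And>j. j \<in> J \<Longrightarrow> continuous_on A (h j)"
  shows "continuous_on A (\<lambda>w. SUP j\<in>J. h j w)"
  using assms
proof (induction J rule: finite_ne_induct)
  case (insert j J)
  have "(SUP j\<in>insert j J. h j w) = max (h j w) (SUP j\<in>J. h j w)" for w
    using insert by (subst cSUP_insert) (auto simp: sup_max)
  thus ?case using insert by (auto intro!: continuous_on_max)
qed simp

context
  fixes J :: "'j set" and l :: "'j \<Rightarrow> (nat \<Rightarrow> real) \<Rightarrow> real"
  assumes J: "finite J" "J \<noteq> {}"
begin

lemma SUP_abs_le_iff: "(SUP j\<in>J. \<bar>l j w\<bar>) \<le> c \<longleftrightarrow> (\<forall>j\<in>J. \<bar>l j w\<bar> \<le> c)"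
  using J by (intro cSUP_le_iff) auto

lemma SUP_abs_nonneg: "(SUP j\<in>J. \<bar>l j w\<bar>) \<ge> 0"
  using J SUP_abs_le_iff[of w "SUP j\<in>J. \<bar>l j w\<bar>"]
  by (metis abs_ge_zero all_not_in_conv dual_order.trans order_refl)

text \<open>Absolute values of affine functions are convex, and so is their supremum.\<close>

lemma SUP_abs_mix_le:
  assumes l: "\<And>j. j \<in> J \<Longrightarrow> l j (mix m e u v) = (1 - e) * l j u + e * l j v"
    and e: "0 \<le> e" "e \<le> 1"
  shows "(SUP j\<in>J. \<bar>l j (mix m e u v)\<bar>) \<le> (1 - e) * (SUP j\<in>J. \<bar>l j u\<bar>) + e * (SUP j\<in>J. \<bar>l j v\<bar>)"
  unfolding SUP_abs_le_iff
proof
  fix j assume j: "j \<in> J"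
  have "\<bar>l j u\<bar> \<le> (SUP j\<in>J. \<bar>l j u\<bar>)" "\<bar>l j v\<bar> \<le> (SUP j\<in>J. \<bar>l j v\<bar>)"
    using SUP_abs_le_iff j by blast+
  hence "(1 - e) * \<bar>l j u\<bar> + e * \<bar>l j v\<bar> \<le> (1 - e) * (SUP j\<in>J. \<bar>l j u\<bar>) + e * (SUP j\<in>J. \<bar>l j v\<bar>)"
    using e by (intro add_mono mult_left_mono) auto
  moreover have "\<bar>l j (mix m e u v)\<bar> \<le> (1 - e) * \<bar>l j u\<bar> + e * \<bar>l j v\<bar>"
    unfolding l[OF j] using e by (intro order_trans[OF abs_triangle_ineq]) (simp add: abs_mult)
  ultimately show "\<bar>l j (mix m e u v)\<bar> \<le> (1 - e) * (SUP j\<in>J. \<bar>l j u\<bar>) + e * (SUP j\<in>J. \<bar>l j v\<bar>)"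
    by linarith
qed

end

section \<open>Integrals against weighted empirical measures\<close>

text \<open>Change of variables moves the integral to the index set, where it is a finite
  sum.\<close>

lemma integral_weighted_empirical:
  fixes g :: "'z \<Rightarrow> real"
  assumes Z: "\<And>i. i \<in> {1..n} \<Longrightarrow> Z i \<in> space M" and g: "g \<in> borel_measurable M"
    and w: "\<And>i. i \<in> {1..n} \<Longrightarrow> w i \<ge> 0"
  shows "(\<integral>z. g z \<partial>weighted_empirical M n Z w) = (\<Sum>i=1..n. w i * g (Z i))"
proof -
  have "(\<integral>z. g z \<partial>weighted_empirical M n Z w) = (\<integral>i. g (Z i) \<partial>point_measure {1..n} (\<lambda>i. ennreal (w i)))"
    unfolding weighted_empirical_def using Z g by (intro integral_distr) auto
  also have "\<dots> = (\<Sum>i=1..n. w i * g (Z i))"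
    using w by (subst lebesgue_integral_point_measure_finite) auto
  finally show ?thesis .
qed

text \<open>Supplies the sigma-finiteness that Fubini requires for the product of the empirical
  marginals.\<close>

lemma finite_measure_weighted_empirical:
  assumes "\<And>i. i \<in> {1..n} \<Longrightarrow> Z i \<in> space M"
  shows "finite_measure (weighted_empirical M n Z w)"
proof
  have "space (weighted_empirical M n Z w) = space M"
    by (simp add: weighted_empirical_def)
  moreover have "emeasure (weighted_empirical M n Z w) (space M) = (\<Sum>i=1..n. ennreal (w i))"
    unfolding weighted_empirical_def using assms
    by (subst emeasure_distr)
       (auto simp: space_point_measure emeasure_point_measure_finite intro!: sum.cong)
  ultimately show "emeasure (weighted_empirical M n Z w) (space (weighted_empirical M n Z w)) \<noteq> \<infinity>"
    by simp
qed

lemma integrable_weighted_empirical: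
  fixes g :: "'z \<Rightarrow> real"
  assumes Z: "\<And>i. i \<in> {1..n} \<Longrightarrow> Z i \<in> space M" and g: "g \<in> borel_measurable M"
    and w: "\<And>i. i \<in> {1..n} \<Longrightarrow> w i \<ge> 0"
  shows "integrable (weighted_empirical M n Z w) g"
  unfolding weighted_empirical_def using assms
  by (subst integrable_distr_eq) (auto intro!: integrable_point_measure_finite)

text \<open>Fubini for a product integrand. It factors the target expectation into an arm share and
  a covariate mean.\<close>

lemma (in pair_sigma_finite) integral_mult_pair:
  fixes h :: "'a \<Rightarrow> real" and g :: "'b \<Rightarrow> real"
  assumes h: "integrable M1 h" and g: "integrable M2 g"
  shows "(\<integral>(x, y). h x * g y \<partial>(M1 \<Otimes>\<^sub>M M2)) = (\<integral>x. h x \<partial>M1) * (\<integral>y. g y \<partial>M2)"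
proof -
  have [measurable]: "h \<in> borel_measurable M1" "g \<in> borel_measurable M2"
    using h g by auto
  have "integrable (M1 \<Otimes>\<^sub>M M2) (\<lambda>(x, y). h x * g y)"
    using h g by (intro Fubini_integrable) (auto simp: abs_mult)
  from integral_fst'[OF this] show ?thesis by simp
qed

text \<open>The ordering of the observations makes arm \<open>s\<close> a contiguous block, which
  the shift by \<open>s * n0\<close> renumbers from 1.\<close>

lemma sum_over_arm:
  fixes h :: "nat \<Rightarrow> real"
  assumes "0 < n0" "n0 < n" and T: "\<And>i. i \<in> {1..n0} \<Longrightarrow> T i = 0" "\<And>i. i \<in> {n0 + 1..n} \<Longrightarrow> T i = 1"
    and s: "s \<in> {0, 1}"
  shows "(\<Sum>i=1..n. of_bool (T i = s) * h i) = (\<Sum>i=1..arm_size n n0 s. h (i + s * n0))"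
proof -
  have split: "{1..n} = {1..n0} \<union> {n0+1..n}" using assms by auto
  have "(\<Sum>i=1..n. of_bool (T i = s) * h i)
      = (\<Sum>i=1..n0. of_bool (T i = s) * h i) + (\<Sum>i=n0+1..n. of_bool (T i = s) * h i)"
    unfolding split by (intro sum.union_disjoint) auto
  also have "\<dots> = (\<Sum>i=1..n0. of_bool (0 = s) * h i) + (\<Sum>i=n0+1..n. of_bool (1 = s) * h i)"
    using T by (intro arg_cong2[where f = "(+)"] sum.cong) auto
  also have "(\<Sum>i=n0+1..n. of_bool (1 = s) * h i) = (\<Sum>i=1..n-n0. of_bool (1 = s) * h (i + n0))"
    using assms sum.shift_bounds_cl_nat_ivl[of "\<lambda>i. of_bool (1 = s) * h i" 1 n0 "n - n0"] by simp
  finally show ?thesis using s by (auto simp: arm_size_def)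
qed

section \<open>The discrepancies of the two arms\<close>

text \<open>The signed difference of the two expectations of \<open>arm_function s (f k)\<close>,
  evaluated explicitly. It depends on \<open>w\<close> only through arm \<open>s\<close>, which
  decouples the two balancing problems.\<close>

definition arm_discrepancy ::
    "nat \<Rightarrow> nat \<Rightarrow> (nat \<Rightarrow> 'x) \<Rightarrow> (nat \<Rightarrow> 'x \<Rightarrow> real) \<Rightarrow> nat \<times> nat \<Rightarrow> (nat \<Rightarrow> real) \<Rightarrow> real" where
  "arm_discrepancy n n0 X f = (\<lambda>(s, k) w.
     (\<Sum>i = 1..arm_size n n0 s. arm_part n n0 s w i * f k (X (i + s * n0)))
       - real (arm_size n n0 s) / real n * covariate_mean n X (f k))"

definition max_discrepancy ::
    "nat \<Rightarrow> nat \<Rightarrow> (nat \<Rightarrow> 'x) \<Rightarrow> nat \<Rightarrow> (nat \<Rightarrow> 'x \<Rightarrow> real) \<Rightarrow> (nat \<Rightarrow> real) \<Rightarrow> real" where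
  "max_discrepancy n n0 X K f w = (SUP p\<in>{0, 1} \<times> {1..K}. \<bar>arm_discrepancy n n0 X f p w\<bar>)"

lemma IPM_arm_class:
  fixes MX :: "'x measure" and X :: "nat \<Rightarrow> 'x" and f :: "nat \<Rightarrow> 'x \<Rightarrow> real"
  assumes n: "0 < n0" "n0 < n"
    and T: "\<And>i. i \<in> {1..n0} \<Longrightarrow> T i = 0" "\<And>i. i \<in> {n0 + 1..n} \<Longrightarrow> T i = 1"
    and X: "\<And>i. i \<in> {1..n} \<Longrightarrow> X i \<in> space MX"
    and f: "\<And>k. k \<in> {1..K} \<Longrightarrow> f k \<in> borel_measurable MX"
    and w: "\<And>i. i \<in> {1..n} \<Longrightarrow> w i \<ge> 0"
  shows "IPM (arm_class K f)
      (weighted_empirical (count_space {0, 1} \<Otimes>\<^sub>M MX) n (\<lambda>i. (T i, X i)) w)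
      (empirical (count_space {0, 1}) n T \<Otimes>\<^sub>M empirical MX n X) = max_discrepancy n n0 X K f w"
proof -
  let ?C = "count_space {0, 1 :: nat}"
  have T01: "T i \<in> {0, 1}" if "i \<in> {1..n}" for i
    using that T(1)[of i] T(2)[of i] by (cases "i \<le> n0") auto
  have fin: "finite_measure (empirical ?C n T)" "finite_measure (empirical MX n X)"
    unfolding empirical_def using T01 X by (intro finite_measure_weighted_empirical; simp)+
  interpret E: pair_sigma_finite "empirical ?C n T" "empirical MX n X"
    using fin by (intro pair_sigma_finite.intro finite_measure.axioms(1))
  have val: "(\<integral>z. arm_function s (f k) z \<partial>weighted_empirical (?C \<Otimes>\<^sub>M MX) n (\<lambda>i. (T i, X i)) w)
      - (\<integral>z. arm_function s (f k) z \<partial>(empirical ?C n T \<Otimes>\<^sub>M empirical MX n X))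
      = arm_discrepancy n n0 X f (s, k) w" if s: "s \<in> {0, 1}" and k: "k \<in> {1..K}" for s k
  proof -
    \<comment> \<open>The treatment factor of \<open>arm_function s\<close>; on the values 0 and 1
      it is the indicator of arm \<open>s\<close>.\<close>
    define h :: "nat \<Rightarrow> real" where "h = (\<lambda>t. if s = 0 then 1 - real t else real t)"
    have af: "arm_function s (f k) = (\<lambda>(t, x). h t * f k x)"
      by (auto simp: arm_function_def h_def)
    have h: "h (T i) = of_bool (T i = s)" if "i \<in> {1..n}" for i
      using T01[OF that] s by (auto simp: h_def)
    note [measurable] = f[OF k]
    have [measurable]: "h \<in> borel_measurable ?C" by simp
    have meas: "(\<lambda>(t, x). h t * f k x) \<in> borel_measurable (?C \<Otimes>\<^sub>M MX)" by measurable
    have "(\<integral>z. arm_function s (f k) z \<partial>weighted_empirical (?C \<Otimes>\<^sub>M MX) n (\<lambda>i. (T i, X i)) w)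
        = (\<Sum>i=1..n. w i * (h (T i) * f k (X i)))"
      unfolding af using T01 X w
      by (subst integral_weighted_empirical[OF _ meas]) (auto simp: space_pair_measure)
    also have "\<dots> = (\<Sum>i=1..n. of_bool (T i = s) * (w i * f k (X i)))"
      by (intro sum.cong refl) (simp add: h)
    also have "\<dots> = (\<Sum>i=1..arm_size n n0 s. w (i + s * n0) * f k (X (i + s * n0)))"
      by (rule sum_over_arm[OF n T s])
    also have "\<dots> = (\<Sum>i=1..arm_size n n0 s. arm_part n n0 s w i * f k (X (i + s * n0)))"
      by (intro sum.cong refl) (simp add: arm_part_def)
    finally have first: "(\<integral>z. arm_function s (f k) z \<partial>weighted_empirical (?C \<Otimes>\<^sub>M MX) n (\<lambda>i. (T i, X i)) w)
        = (\<Sum>i=1..arm_size n n0 s. arm_part n n0 s w i * f k (X (i + s * n0)))" .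
    have "(\<integral>t. h t \<partial>empirical ?C n T) = (\<Sum>i=1..n. 1 / real n * h (T i))"
      unfolding empirical_def using T01 by (subst integral_weighted_empirical) auto
    also have "\<dots> = (\<Sum>i=1..n. of_bool (T i = s) * (1 / real n))"
      by (intro sum.cong refl) (simp add: h)
    also have "\<dots> = (\<Sum>i=1..arm_size n n0 s. 1 / real n)"
      by (rule sum_over_arm[OF n T s])
    also have "\<dots> = real (arm_size n n0 s) / real n" by simp
    finally have "(\<integral>t. h t \<partial>empirical ?C n T) = real (arm_size n n0 s) / real n" .
    moreover have "(\<integral>x. f k x \<partial>empirical MX n X) = covariate_mean n X (f k)"
      unfolding empirical_def covariate_mean_def using X f[OF k]
      by (subst integral_weighted_empirical) (auto simp: sum_distrib_left)
    moreover have "(\<integral>(t, x). h t * f k x \<partial>(empirical ?C n T \<Otimes>\<^sub>M empirical MX n X))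
        = (\<integral>t. h t \<partial>empirical ?C n T) * (\<integral>x. f k x \<partial>empirical MX n X)"
      using T01 X f[OF k] unfolding empirical_def
      by (intro E.integral_mult_pair[unfolded empirical_def] integrable_weighted_empirical) auto
    ultimately show ?thesis using first by (simp add: arm_discrepancy_def af)
  qed
  have cls: "arm_class K f = (\<lambda>(s, k). arm_function s (f k)) ` ({0, 1} \<times> {1..K})"
    by (auto simp: arm_class_def) blast+
  show ?thesis
    unfolding IPM_def max_discrepancy_def cls image_image
    using val by (intro SUP_cong refl) auto
qed

section \<open>Convexity of the constraints and separation of the norm into arms\<close>

lemma arm_index: "n0 < n \<Longrightarrow> s \<in> {0, 1} \<Longrightarrow> i \<in> {1..arm_size n n0 s} \<Longrightarrow> i + s * n0 \<in> {1..n}"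
  by (auto simp: arm_size_def)

lemma arm_part_mix:
  assumes "n0 < n" "s \<in> {0, 1}"
  shows "arm_part n n0 s (mix n e u v) = mix (arm_size n n0 s) e (arm_part n n0 s u) (arm_part n n0 s v)"
  using arm_index[OF assms] by (fastforce simp: arm_part_def mix_def)

text \<open>The discrepancy is affine in the weights: its constant term is preserved because
  \<open>1 - e\<close> and \<open>e\<close> sum to 1.\<close>

lemma arm_discrepancy_mix:
  assumes "n0 < n" "fst p \<in> {0, 1}"
  shows "arm_discrepancy n n0 X f p (mix n e u v)
    = (1 - e) * arm_discrepancy n n0 X f p u + e * arm_discrepancy n n0 X f p v"
proof -
  obtain s k where p: "p = (s, k)" by force
  have s: "s \<in> {0, 1}" using assms p by simp
  show ?thesis
    unfolding p arm_discrepancy_def prod.case arm_part_mix[OF assms(1) s] sum_mix_mult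
    by argo
qed

lemma mix_in_arm_simplex:
  assumes "n0 < n" "u \<in> arm_simplex n n0" "v \<in> arm_simplex n n0" "0 \<le> e" "e \<le> 1"
  shows "mix n e u v \<in> arm_simplex n n0"
proof -
  have "mix n e u v \<in> {1..n} \<rightarrow>\<^sub>E {0..}"
    using assms by (auto simp: mix_def arm_simplex_def PiE_iff)
  moreover have "(\<Sum>i = 1..arm_size n n0 t. arm_part n n0 t (mix n e u v) i)
      = real (arm_size n n0 t) / real n" if t: "t \<in> {0, 1}" for t
  proof -
    have "(\<Sum>i = 1..arm_size n n0 t. arm_part n n0 t u i) = real (arm_size n n0 t) / real n"
      "(\<Sum>i = 1..arm_size n n0 t. arm_part n n0 t v i) = real (arm_size n n0 t) / real n"
      using assms(2,3) t unfolding arm_simplex_def by blast+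
    thus ?thesis
      unfolding arm_part_mix[OF assms(1) t] sum_mix by (simp only: flip: distrib_right) simp
  qed
  ultimately show ?thesis by (simp add: arm_simplex_def)
qed

lemma sum_split_arms:
  fixes h :: "nat \<Rightarrow> real"
  assumes "n0 < n"
  shows "(\<Sum>i=1..n. h i) = (\<Sum>t\<in>{0, 1}. \<Sum>i=1..arm_size n n0 t. h (i + t * n0))"
proof -
  have "{1..n} = {1..n0} \<union> {n0+1..n}" using assms by auto
  hence "(\<Sum>i=1..n. h i) = (\<Sum>i=1..n0. h i) + (\<Sum>i=n0+1..n. h i)"
    by (simp add: sum.union_disjoint)
  also have "(\<Sum>i=n0+1..n. h i) = (\<Sum>i=1..n-n0. h (i + n0))"
    using assms sum.shift_bounds_cl_nat_ivl[of h 1 n0 "n - n0"] by simp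
  finally show ?thesis by (simp add: arm_size_def)
qed

text \<open>Separability of the penalty: exchanging one arm affects only its own summand.\<close>

lemma L2_set_split_arms:
  assumes "n0 < n"
  shows "(L2_set w {1..n})\<^sup>2 = (\<Sum>t\<in>{0, 1}. (L2_set (arm_part n n0 t w) {1..arm_size n n0 t})\<^sup>2)"
  unfolding L2_set_power2 sum_split_arms[OF assms] by (simp add: arm_part_def)

section \<open>Compactness and nonemptiness of the arm simplex\<close>

lemma continuous_on_coordinate: "continuous_on A (\<lambda>w :: nat \<Rightarrow> real. w i)"
  by (rule continuous_on_subset[OF continuous_on_product_coordinates]) simp

lemma continuous_on_arm_part:
  "i \<in> {1..arm_size n n0 t} \<Longrightarrow> continuous_on A (\<lambda>w. arm_part n n0 t w i)"
  by (simp add: arm_part_def continuous_on_coordinate)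

lemma continuous_on_arm_discrepancy: "continuous_on A (arm_discrepancy n n0 X f p)"
  unfolding arm_discrepancy_def case_prod_unfold
  by (intro continuous_on_diff continuous_on_sum continuous_on_mult_right continuous_on_arm_part
      continuous_on_const)

text \<open>The entries are nonnegative with total 1, so the set is the intersection of a compact
  cube with closed sum constraints.\<close>

lemma compact_arm_simplex:
  assumes "n0 < n"
  shows "compact (arm_simplex n n0)"
proof -
  let ?B = "{1..n} \<rightarrow>\<^sub>E {0..1 :: real}"
  \<comment> \<open>The topology is the product topology over all naturals, so the cube is written
    as a full product with the compact factor \<open>{undefined}\<close> at every index outside
    \<open>{1..n}\<close>.\<close>
  let ?S = "\<lambda>i. if i \<in> {1..n} then {0..1 :: real} else {undefined}"
  have "?B = PiE UNIV ?S" by (auto simp: PiE_def Pi_def extensional_def split: if_splits)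
  moreover have "compactin (product_topology (\<lambda>_. euclidean) UNIV) (PiE UNIV ?S)"
    unfolding compactin_PiE by auto
  ultimately have B: "compact ?B"
    by (simp add: euclidean_product_topology)
  let ?A = "\<Inter>t\<in>{0, 1}. {w. (\<Sum>i = 1..arm_size n n0 t. arm_part n n0 t w i) = real (arm_size n n0 t) / real n}"
  have "closed ?A"
    by (intro closed_INT ballI closed_Collect_eq continuous_on_sum continuous_on_arm_part continuous_on_const)
  moreover have "arm_simplex n n0 = ?B \<inter> ?A"
  proof -
    have le: "w i \<le> 1" if w: "w \<in> arm_simplex n n0" and i: "i \<in> {1..n}" for w i
    proof -
      have "w i \<le> (\<Sum>i=1..n. w i)"
        using w i by (intro member_le_sum) (auto simp: arm_simplex_def PiE_iff)
      also have "\<dots> = (\<Sum>t\<in>{0, 1}. real (arm_size n n0 t) / real n)"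
        using w unfolding sum_split_arms[OF assms] by (auto simp: arm_simplex_def arm_part_def)
      also have "\<dots> = 1" using assms by (simp add: arm_size_def field_simps)
      finally show ?thesis .
    qed
    have "w \<in> ?B" if "w \<in> arm_simplex n n0" for w
      using that le[OF that] by (simp add: arm_simplex_def PiE_iff)
    moreover have "?B \<subseteq> {1..n} \<rightarrow>\<^sub>E {0..}" by (intro PiE_mono) auto
    ultimately show ?thesis unfolding arm_simplex_def by blast
  qed
  ultimately show ?thesis using B by (simp add: compact_Int_closed)
qed

lemma uniform_in_arm_simplex:
  assumes "n0 < n"
  shows "(\<lambda>i\<in>{1..n}. 1 / real n) \<in> arm_simplex n n0"
proof -
  have "(\<Sum>i = 1..arm_size n n0 t. arm_part n n0 t (\<lambda>i\<in>{1..n}. 1 / real n) i)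
      = (\<Sum>i = 1..arm_size n n0 t. 1 / real n)" if "t \<in> {0, 1}" for t
    using arm_index[OF assms that] by (intro sum.cong) (simp_all add: arm_part_def)
  thus ?thesis by (simp add: arm_simplex_def)
qed

section \<open>Exchange of one arm and the rescaled balancing constraints\<close>

text \<open>For \<open>t\<close> in \<open>{0, 1}\<close> the test
  \<open>(t = 0) = (i \<le> n0)\<close> says that observation \<open>i\<close> belongs to arm
  \<open>t\<close>; subtracting \<open>t * n0\<close> undoes the shift in
  \<open>arm_part\<close>.\<close>

definition replace_arm ::
    "nat \<Rightarrow> nat \<Rightarrow> nat \<Rightarrow> (nat \<Rightarrow> real) \<Rightarrow> (nat \<Rightarrow> real) \<Rightarrow> nat \<Rightarrow> real" where
  "replace_arm n n0 t v w =
     (\<lambda>i\<in>{1..n}. if (t = 0) = (i \<le> n0) then v (i - t * n0) else w i)"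

lemma arm_part_replace_arm:
  assumes "n0 < n" "s \<in> {0, 1}" "t \<in> {0, 1}" "v \<in> extensional {1..arm_size n n0 t}"
  shows "arm_part n n0 s (replace_arm n n0 t v w) = (if s = t then v else arm_part n n0 s w)"
proof
  fix i
  show "arm_part n n0 s (replace_arm n n0 t v w) i = (if s = t then v else arm_part n n0 s w) i"
    using assms by (auto simp: arm_part_def replace_arm_def arm_size_def extensional_def)
qed

text \<open>Multiplication by n_t / n turns the simplex condition into the mass constraint of
  \<open>arm_simplex\<close>, and each imbalance into the corresponding
  \<open>arm_discrepancy\<close>. The tolerance is scaled by the same factor.\<close>

lemma balancing_feasible_iff:
  assumes n: "0 < n0" "n0 < n" and t: "t \<in> {0, 1}"
  shows "v \<in> balancing_feasible n n0 X K f t \<delta> \<longleftrightarrow>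
    v \<in> {1..arm_size n n0 t} \<rightarrow>\<^sub>E {0..} \<and>
    (\<Sum>i=1..arm_size n n0 t. v i) = real (arm_size n n0 t) / real n \<and>
    (\<forall>k\<in>{1..K}. \<bar>(\<Sum>i = 1..arm_size n n0 t. v i * f k (X (i + t * n0)))
       - real (arm_size n n0 t) / real n * covariate_mean n X (f k)\<bar>
         \<le> \<delta> * (real (arm_size n n0 t) / real n))"
proof -
  define nt where "nt = arm_size n n0 t"
  have nt: "nt > 0" using n t by (auto simp: nt_def arm_size_def)
  have "n > 0" using n by simp
  have bal: "\<bar>1 / real nt * (\<Sum>i = 1..nt. real n * v i * f k (X (i + t * n0))) - m\<bar> \<le> \<delta> \<longleftrightarrow>
      \<bar>(\<Sum>i = 1..nt. v i * f k (X (i + t * n0))) - real nt / real n * m\<bar> \<le> \<delta> * (real nt / real n)"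
    for k m
  proof -
    \<comment> \<open>The imbalance in the original scaling; the discrepancy is \<open>a\<close>
      times the positive factor \<open>real nt / real n\<close>.\<close>
    define a where "a = 1 / real nt * (\<Sum>i = 1..nt. real n * v i * f k (X (i + t * n0))) - m"
    have "a = 1 / real nt * (real n * (\<Sum>i = 1..nt. v i * f k (X (i + t * n0)))) - m"
      unfolding a_def by (simp add: sum_distrib_left mult.assoc)
    hence "(\<Sum>i = 1..nt. v i * f k (X (i + t * n0))) - real nt / real n * m = a * (real nt / real n)"
      using nt \<open>n > 0\<close> by (simp add: field_simps)
    moreover have "\<bar>a * (real nt / real n)\<bar> \<le> \<delta> * (real nt / real n) \<longleftrightarrow> \<bar>a\<bar> \<le> \<delta>"
      using nt \<open>n > 0\<close> by (simp only: abs_mult) (simp add: divide_le_cancel)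
    ultimately show ?thesis unfolding a_def by simp
  qed
  have nonneg: "0 \<le> real n * v i / real nt \<longleftrightarrow> 0 \<le> v i" for i
    using nt \<open>n > 0\<close> by (simp add: zero_le_divide_iff zero_le_mult_iff)
  have "(\<Sum>i = 1..nt. real n * v i / real nt) = real n / real nt * (\<Sum>i=1..nt. v i)"
    by (simp add: sum_distrib_left)
  hence total: "(\<Sum>i = 1..nt. real n * v i / real nt) = 1 \<longleftrightarrow> (\<Sum>i=1..nt. v i) = real nt / real n"
    using nt \<open>n > 0\<close> by (simp only:) (auto simp: field_simps)
  have "(\<lambda>i\<in>{1..nt}. real n / real nt * v i) \<in> unit_simplex nt \<longleftrightarrow>
      (\<forall>i\<in>{1..nt}. 0 \<le> v i) \<and> (\<Sum>i=1..nt. v i) = real nt / real n"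
    using nonneg total by (auto simp: unit_simplex_def PiE_iff)
  thus ?thesis
    unfolding balancing_feasible_def Let_def nt_def[symmetric] mem_Collect_eq bal
    by (auto simp: PiE_iff)
qed

text \<open>Convexity of the feasible set, needed for uniqueness of the balancing weights.\<close>

lemma mix_in_balancing_feasible:
  assumes n: "0 < n0" "n0 < n" and t: "t \<in> {0, 1}"
    and u: "u \<in> balancing_feasible n n0 X K f t \<delta>" and v: "v \<in> balancing_feasible n n0 X K f t \<delta>"
    and e: "0 \<le> e" "e \<le> 1"
  shows "mix (arm_size n n0 t) e u v \<in> balancing_feasible n n0 X K f t \<delta>"
proof -
  define nt where "nt = arm_size n n0 t"
  note iff = balancing_feasible_iff[OF n t, folded nt_def]
  let ?d = "\<lambda>k v. (\<Sum>i = 1..nt. v i * f k (X (i + t * n0))) - real nt / real n * covariate_mean n X (f k)"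
  let ?c = "\<delta> * (real nt / real n)"
  have "(\<Sum>i=1..nt. u i) = real nt / real n" "(\<Sum>i=1..nt. v i) = real nt / real n"
    using u v unfolding iff by blast+
  hence sum: "(\<Sum>i=1..nt. mix nt e u v i) = real nt / real n"
    unfolding sum_mix by (simp only: flip: distrib_right) simp
  have disc: "\<bar>?d k (mix nt e u v)\<bar> \<le> ?c" if k: "k \<in> {1..K}" for k
  proof -
    have "?d k (mix nt e u v) = (1 - e) * ?d k u + e * ?d k v"
      unfolding sum_mix_mult by argo
    hence "\<bar>?d k (mix nt e u v)\<bar> \<le> (1 - e) * \<bar>?d k u\<bar> + e * \<bar>?d k v\<bar>"
      using e by (simp only:) (intro order_trans[OF abs_triangle_ineq], simp add: abs_mult)
    also have "\<dots> \<le> (1 - e) * ?c + e * ?c"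
      using u v k e unfolding iff by (intro add_mono mult_left_mono) auto
    finally show ?thesis by argo
  qed
  have "mix nt e u v \<in> {1..nt} \<rightarrow>\<^sub>E {0..}"
    using u v e unfolding iff by (auto simp: mix_def PiE_iff)
  with sum disc show ?thesis
    unfolding nt_def[symmetric] iff by blast
qed

text \<open>\<open>arg_min\<close> is a Hilbert choice, so it is identified by showing that there is
  only one candidate.\<close>

lemma is_arg_min_unique_imp_arg_min:
  assumes "is_arg_min f P x" "\<And>y. is_arg_min f P y \<Longrightarrow> y = x"
  shows "arg_min f P = x"
  using assms unfolding arg_min_def by (metis someI)

text \<open>The existence and uniqueness claims ensure that the final equation compares genuine
  minimizers, not arbitrary values of \<open>arg_min\<close>.\<close>

theorem proposition1:
  fixes MX :: "'x measure"
    and n n0 K :: nat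
    and T :: "nat \<Rightarrow> nat"
    and X :: "nat \<Rightarrow> 'x"
    and f :: "nat \<Rightarrow> 'x \<Rightarrow> real"
    and lam :: real
  assumes "0 < n0" and "n0 < n"
    and "\<And>i. i \<in> {1..n0} \<Longrightarrow> T i = 0"
    and "\<And>i. i \<in> {n0 + 1..n} \<Longrightarrow> T i = 1"
    and "\<And>i. i \<in> {1..n} \<Longrightarrow> X i \<in> space MX"
    and "1 \<le> K"
    and "\<And>k. k \<in> {1..K} \<Longrightarrow> f k \<in> borel_measurable MX"
    and "0 < lam"
  shows "(\<exists>!w. is_arg_min (ipm_objective MX n T X K f lam) (\<lambda>w. w \<in> arm_simplex n n0) w) \<and>
    (\<exists>\<delta> :: nat \<Rightarrow> real. \<delta> 0 > 0 \<and> \<delta> 1 > 0 \<and>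
       (\<forall>t\<in>{0, 1}.
          (\<exists>!v. is_arg_min (balancing_objective n n0 t)
                  (\<lambda>v. v \<in> balancing_feasible n n0 X K f t (\<delta> t)) v) \<and>
          arm_part n n0 t (ipm_weights MX n n0 T X K f lam)
            = balancing_weights n n0 X K f t (\<delta> t)))"
proof -
  note n = assms(1,2)
  let ?J = "{0, 1 :: nat} \<times> {1..K}"
  let ?D = "max_discrepancy n n0 X K f"
  let ?obj = "\<lambda>w. (?D w)\<^sup>2 + lam * (L2_set w {1..n})\<^sup>2"
  let ?S = "arm_simplex n n0"
  \<comment> \<open>\<open>1 \<le> K\<close> makes the index set nonempty, so the real supremum is a
    true maximum.\<close>
  have J: "finite ?J" "?J \<noteq> {}" using \<open>1 \<le> K\<close> by auto
  \<comment> \<open>The agreement is claimed only on the simplex, where the weights are nonnegative;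
    minimizers over it see no other points.\<close>
  have obj: "ipm_objective MX n T X K f lam w = ?obj w" if "w \<in> ?S" for w
    unfolding ipm_objective_def using that
    by (subst IPM_arm_class[OF n assms(3,4,5,7)]) (auto simp: arm_simplex_def PiE_iff)
  have arg_obj: "is_arg_min (ipm_objective MX n T X K f lam) (\<lambda>w. w \<in> ?S) w
      \<longleftrightarrow> is_arg_min ?obj (\<lambda>w. w \<in> ?S) w" for w
    unfolding is_arg_min_def using obj by auto

  have D_nonneg: "?D w \<ge> 0" for w
    unfolding max_discrepancy_def by (rule SUP_abs_nonneg[OF J])
  have D_mix: "?D (mix n e u v) \<le> (1 - e) * ?D u + e * ?D v" if "0 \<le> e" "e \<le> 1" for e u v
    unfolding max_discrepancy_def using that
    by (intro SUP_abs_mix_le[OF J] arm_discrepancy_mix n) auto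
  \<comment> \<open>Squaring preserves midpoint convexity because \<open>?D\<close> is
    nonnegative.\<close>
  have D_mid: "(?D (mix n (1/2) u v))\<^sup>2 \<le> ((?D u)\<^sup>2 + (?D v)\<^sup>2) / 2" for u v
  proof -
    have "?D (mix n (1/2) u v) \<le> (?D u + ?D v) / 2"
      using D_mix[of "1/2" u v] by simp
    hence "(?D (mix n (1/2) u v))\<^sup>2 \<le> ((?D u + ?D v) / 2)\<^sup>2"
      using D_nonneg by (intro power_mono) auto
    also have "\<dots> \<le> ((?D u)\<^sup>2 + (?D v)\<^sup>2) / 2"
      using zero_le_power2[of "?D u - ?D v"] by (simp add: power2_eq_square field_simps)
    finally show ?thesis .
  qed

  \<comment> \<open>Existence: a continuous function attains its infimum on a nonempty compact
    set.\<close>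
  have "continuous_on ?S ?obj"
    unfolding max_discrepancy_def L2_set_power2
    by (intro continuous_on_add continuous_on_mult continuous_on_power continuous_on_sum
        continuous_on_const continuous_on_coordinate continuous_on_SUP_finite J
        continuous_on_rabs continuous_on_arm_discrepancy)
  moreover have "?S \<noteq> {}" using uniform_in_arm_simplex[OF n(2)] by blast
  ultimately obtain w where w: "is_arg_min ?obj (\<lambda>w. w \<in> ?S) w"
    using continuous_attains_inf[OF compact_arm_simplex[OF n(2)]]
    unfolding is_arg_min_linorder by blast
  have wS: "w \<in> ?S" using w by (simp add: is_arg_min_def)
  have w_unique: "u = w" if "is_arg_min ?obj (\<lambda>w. w \<in> ?S) u" for u
  proof (rule is_arg_min_penalized_unique[OF that w])
    show "?S \<subseteq> extensional {1..n}" by (auto simp: arm_simplex_def PiE_iff)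
    show "mix n (1/2) u w \<in> ?S"
      using that wS n by (intro mix_in_arm_simplex) (auto simp: is_arg_min_def)
  qed (use D_mid \<open>0 < lam\<close> in auto)
  have ipm: "ipm_weights MX n n0 T X K f lam = w"
    unfolding ipm_weights_def
    by (rule is_arg_min_unique_imp_arg_min) (use w w_unique arg_obj in blast)+

  obtain \<mu> where \<mu>: "\<mu> > 0" "?D w \<le> \<mu>"
    and norm_min: "\<And>u. u \<in> ?S \<Longrightarrow> ?D u \<le> \<mu> \<Longrightarrow> (L2_set w {1..n})\<^sup>2 \<le> (L2_set u {1..n})\<^sup>2"
    using penalized_arg_min_constrained[OF w mix_in_arm_simplex[OF n(2)] D_nonneg D_mix \<open>0 < lam\<close>]
    by blast
  have D_le: "?D u \<le> \<mu> \<longleftrightarrow> (\<forall>s\<in>{0, 1}. \<forall>k\<in>{1..K}. \<bar>arm_discrepancy n n0 X f (s, k) u\<bar> \<le> \<mu>)" for u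
    unfolding max_discrepancy_def SUP_abs_le_iff[OF J] by auto
  \<comment> \<open>Chosen to cancel the factor n_t / n of \<open>balancing_feasible_iff\<close>:
    both arms then face the same discrepancy bound \<mu>.\<close>
  define \<delta> where "\<delta> = (\<lambda>t. real n / real (arm_size n n0 t) * \<mu>)"
  have size: "arm_size n n0 t > 0" for t using n by (simp add: arm_size_def)
  have \<delta>_pos: "\<delta> t > 0" for t using \<mu> size[of t] n by (simp add: \<delta>_def)
  have \<delta>_eq: "\<delta> t * (real (arm_size n n0 t) / real n) = \<mu>" for t
    using size[of t] n by (simp add: \<delta>_def)

  have arm: "is_arg_min (balancing_objective n n0 t)
      (\<lambda>v. v \<in> balancing_feasible n n0 X K f t (\<delta> t)) (arm_part n n0 t w)" if t: "t \<in> {0, 1}" for t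
  proof -
    have "arm_part n n0 t w \<in> {1..arm_size n n0 t} \<rightarrow>\<^sub>E {0..}"
      using wS arm_index[OF n(2) t] by (auto simp: arm_part_def arm_simplex_def PiE_iff)
    hence feas: "arm_part n n0 t w \<in> balancing_feasible n n0 X K f t (\<delta> t)"
      using wS \<mu>(2) t unfolding balancing_feasible_iff[OF n t] \<delta>_eq D_le
      by (auto simp: arm_simplex_def arm_discrepancy_def)
    have "balancing_objective n n0 t (arm_part n n0 t w) \<le> balancing_objective n n0 t v"
      if v: "v \<in> balancing_feasible n n0 X K f t (\<delta> t)" for v
    proof -
      define u where "u = replace_arm n n0 t v w"
      have v': "v \<in> {1..arm_size n n0 t} \<rightarrow>\<^sub>E {0..}"
        and v_sum: "(\<Sum>i=1..arm_size n n0 t. v i) = real (arm_size n n0 t) / real n"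
        using v unfolding balancing_feasible_iff[OF n t] by blast+
      have v_nonneg: "v j \<ge> 0" if "1 \<le> j" "j \<le> arm_size n n0 t" for j
        using v' that by (auto simp: PiE_iff)
      have part: "arm_part n n0 s u = (if s = t then v else arm_part n n0 s w)" if "s \<in> {0, 1}" for s
        unfolding u_def using n t that v' by (intro arm_part_replace_arm) (auto simp: PiE_iff)
      have "u \<in> {1..n} \<rightarrow>\<^sub>E {0..}"
        using v_nonneg wS n t unfolding u_def replace_arm_def
        by (auto simp: arm_simplex_def PiE_iff arm_size_def)
      moreover have "(\<Sum>i=1..arm_size n n0 s. arm_part n n0 s u i) = real (arm_size n n0 s) / real n"
        if "s \<in> {0, 1}" for s
        using that v_sum wS part[OF that] by (auto simp: arm_simplex_def)
      ultimately have "u \<in> ?S" by (simp add: arm_simplex_def)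
      \<comment> \<open>In arm \<open>t\<close> the bound is the feasibility of \<open>v\<close>; in
        the other arm it is inherited from \<open>w\<close>.\<close>
      moreover have "\<bar>arm_discrepancy n n0 X f (s, k) u\<bar> \<le> \<mu>" if "s \<in> {0, 1}" "k \<in> {1..K}" for s k
        using \<mu>(2) v that unfolding D_le balancing_feasible_iff[OF n t] \<delta>_eq
        by (cases "s = t") (auto simp: arm_discrepancy_def part)
      hence "?D u \<le> \<mu>" unfolding D_le by blast
      ultimately have "(L2_set w {1..n})\<^sup>2 \<le> (L2_set u {1..n})\<^sup>2" by (rule norm_min)
      \<comment> \<open>The untouched arm contributes equally to both norms and cancels.\<close>
      thus ?thesis
        unfolding L2_set_split_arms[OF n(2)] balancing_objective_def
        using t by (auto simp: part)
    qed
    with feas show ?thesis unfolding is_arg_min_linorder by blast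
  qed
  have arm_unique: "v = arm_part n n0 t w"
    if t: "t \<in> {0, 1}" and v: "is_arg_min (balancing_objective n n0 t)
      (\<lambda>v. v \<in> balancing_feasible n n0 X K f t (\<delta> t)) v" for t v
  \<comment> \<open>The balancing objective is the squared norm alone, so its strict convexity
    suffices.\<close>
  proof (rule is_arg_min_penalized_unique[where g = "\<lambda>_. 0" and c = 1])
    show "balancing_feasible n n0 X K f t (\<delta> t) \<subseteq> extensional {1..arm_size n n0 t}"
      by (auto simp: balancing_feasible_def Let_def PiE_iff)
    show "mix (arm_size n n0 t) (1/2) v (arm_part n n0 t w) \<in> balancing_feasible n n0 X K f t (\<delta> t)"
      using v arm[OF t] n t by (intro mix_in_balancing_feasible) (auto simp: is_arg_min_def)
  qed (use v arm[OF t] in \<open>simp_all add: balancing_objective_def[abs_def]\<close>)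
  have "\<forall>t\<in>{0, 1}. (\<exists>!v. is_arg_min (balancing_objective n n0 t)
          (\<lambda>v. v \<in> balancing_feasible n n0 X K f t (\<delta> t)) v) \<and>
        arm_part n n0 t (ipm_weights MX n n0 T X K f lam) = balancing_weights n n0 X K f t (\<delta> t)"
  proof (intro ballI conjI)
    fix t :: nat assume t: "t \<in> {0, 1}"
    show "\<exists>!v. is_arg_min (balancing_objective n n0 t)
          (\<lambda>v. v \<in> balancing_feasible n n0 X K f t (\<delta> t)) v"
      using arm[OF t] arm_unique[OF t] by blast
    show "arm_part n n0 t (ipm_weights MX n n0 T X K f lam) = balancing_weights n n0 X K f t (\<delta> t)"
      unfolding ipm balancing_weights_def
      using is_arg_min_unique_imp_arg_min[OF arm[OF t] arm_unique[OF t]] by simp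
  qed
  with \<delta>_pos show ?thesis
    unfolding arg_obj using w w_unique by blast
qed

end
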